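(* Suppose that $D$ is a Banach algebra which is an essential ideal in a commutative Arens regular Banach algebra $A$. Assume that $A$ is weakly compact and that $D$ has a bounded approximate identity. Then $A=D$.
   Context: The ideal $D$ of $A$ is called essential if the canonical representation of $A$ on $D$, sending $a\in A$ to the map $d\mapsto ad$ on $D$, is one-to-one. A Banach algebra $A$ is Arens regular if the two Arens products on its bidual $A^{**}$ coincide. A commutative Banach algebra $A$ is called weakly compact if for every $a\in A$ the operator $b\mapsto ab$ on $A$ is weakly compact. *)

theory Defs
  imports "HOL-Analysis.Analysis"
begin

text \<open>
  The scalar field is any type of sort \<open>{real_normed_field, euclidean_space}\<close>. Both \<^typ>\<open>real\<close>
  and \<^typ>\<open>complex\<close> have this sort, and up to isomorphism (Frobenius) they are the only such fields,
  so real and complex Banach algebras are treated together. The classes of \<open>'a\<close> supply the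
  complete submultiplicative norm; no unit is assumed.
\<close>

locale banach_algebra_over = vector_space smul
  for smul :: "'k::{real_normed_field, euclidean_space} \<Rightarrow> 'a::{real_normed_algebra, banach} \<Rightarrow> 'a" +
  assumes scale_of_real: "smul (of_real r) x = r *\<^sub>R x"
    and norm_scale: "norm (smul c x) = norm c * norm x"
    and scale_mult_left: "smul c x * y = smul c (x * y)"
    and scale_mult_right: "x * smul c y = smul c (x * y)"

definition dual_space ::
  "('k::{real_normed_field, euclidean_space} \<Rightarrow> 'a::{real_normed_algebra, banach} \<Rightarrow> 'a) \<Rightarrow> ('a \<Rightarrow> 'k) set"
  where "dual_space smul = {f. bounded_linear f \<and> (\<forall>c x. f (smul c x) = c * f x)}"

text \<open>Only the values of \<open>F\<close> on the dual space are meaningful; \<^const>\<open>onorm\<close> is the dual norm.\<close>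

definition bidual_space ::
  "('k::{real_normed_field, euclidean_space} \<Rightarrow> 'a::{real_normed_algebra, banach} \<Rightarrow> 'a)
    \<Rightarrow> (('a \<Rightarrow> 'k) \<Rightarrow> 'k) set"
  where "bidual_space smul = {F.
    (\<forall>f\<in>dual_space smul. \<forall>g\<in>dual_space smul. F (\<lambda>x. f x + g x) = F f + F g) \<and>
    (\<forall>c. \<forall>f\<in>dual_space smul. F (\<lambda>x. c * f x) = c * F f) \<and>
    (\<exists>M. \<forall>f\<in>dual_space smul. norm (F f) \<le> M * onorm f)}"

text \<open>
  First product: \<open>(F \<box> G)(f) = F(G \<cdot> f)\<close>, where \<open>(G \<cdot> f)(a) = G(f \<cdot> a)\<close> and \<open>(f \<cdot> a)(b) = f(a b)\<close>.
  Second product: \<open>(F \<diamond> G)(f) = G(f \<cdot> F)\<close>, where \<open>(f \<cdot> F)(a) = F(a \<cdot> f)\<close> and \<open>(a \<cdot> f)(b) = f(b a)\<close>.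
\<close>

definition first_arens_product ::
  "(('a::{real_normed_algebra, banach} \<Rightarrow> 'k) \<Rightarrow> 'k) \<Rightarrow> (('a \<Rightarrow> 'k) \<Rightarrow> 'k) \<Rightarrow> ('a \<Rightarrow> 'k) \<Rightarrow> 'k"
  where "first_arens_product F G = (\<lambda>f. F (\<lambda>a. G (\<lambda>b. f (a * b))))"

definition second_arens_product ::
  "(('a::{real_normed_algebra, banach} \<Rightarrow> 'k) \<Rightarrow> 'k) \<Rightarrow> (('a \<Rightarrow> 'k) \<Rightarrow> 'k) \<Rightarrow> ('a \<Rightarrow> 'k) \<Rightarrow> 'k"
  where "second_arens_product F G = (\<lambda>f. G (\<lambda>a. F (\<lambda>b. f (b * a))))"

definition arens_regular ::
  "('k::{real_normed_field, euclidean_space} \<Rightarrow> 'a::{real_normed_algebra, banach} \<Rightarrow> 'a) \<Rightarrow> bool"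
  where "arens_regular smul \<longleftrightarrow>
    (\<forall>F\<in>bidual_space smul. \<forall>G\<in>bidual_space smul. \<forall>f\<in>dual_space smul.
      first_arens_product F G f = second_arens_product F G f)"

definition weak_topology ::
  "('k::{real_normed_field, euclidean_space} \<Rightarrow> 'a::{real_normed_algebra, banach} \<Rightarrow> 'a) \<Rightarrow> 'a topology"
  where "weak_topology smul =
    topology_generated_by {f -` U | f U. f \<in> dual_space smul \<and> open U}"

definition weakly_compact_operator ::
  "('k::{real_normed_field, euclidean_space} \<Rightarrow> 'a::{real_normed_algebra, banach} \<Rightarrow> 'a)
    \<Rightarrow> ('a \<Rightarrow> 'a) \<Rightarrow> bool"
  where "weakly_compact_operator smul T \<longleftrightarrow>
    bounded_linear T \<and> (\<forall>c x. T (smul c x) = smul c (T x)) \<and>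
    compactin (weak_topology smul) (weak_topology smul closure_of (T ` cball 0 1))"

definition weakly_compact_algebra ::
  "('k::{real_normed_field, euclidean_space} \<Rightarrow> 'a::{real_normed_algebra, banach} \<Rightarrow> 'a) \<Rightarrow> bool"
  where "weakly_compact_algebra smul \<longleftrightarrow> (\<forall>a. weakly_compact_operator smul (\<lambda>b. a * b))"

definition algebra_ideal ::
  "('k::{real_normed_field, euclidean_space} \<Rightarrow> 'a::{real_normed_algebra, banach} \<Rightarrow> 'a)
    \<Rightarrow> 'a set \<Rightarrow> bool"
  where "algebra_ideal smul D \<longleftrightarrow>
    module.subspace smul D \<and> (\<forall>a. \<forall>d\<in>D. a * d \<in> D \<and> d * a \<in> D)"

definition essential_ideal ::
  "('k::{real_normed_field, euclidean_space} \<Rightarrow> 'a::{real_normed_algebra, banach} \<Rightarrow> 'a)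
    \<Rightarrow> 'a set \<Rightarrow> bool"
  where "essential_ideal smul D \<longleftrightarrow>
    algebra_ideal smul D \<and> inj (\<lambda>a. restrict (\<lambda>d. a * d) D)"

text \<open>
  The ideal \<open>D\<close> is a Banach algebra in a norm \<open>N\<close> of its own, which need not be the restriction of
  the norm of \<open>A\<close>; as usual for a Banach algebra sitting inside another one, the inclusion is
  continuous. A closed ideal with the norm inherited from \<open>A\<close> is the special case \<open>N = norm\<close>.
\<close>

definition complete_algebra_norm_on ::
  "('k::{real_normed_field, euclidean_space} \<Rightarrow> 'a::{real_normed_algebra, banach} \<Rightarrow> 'a)
    \<Rightarrow> 'a set \<Rightarrow> ('a \<Rightarrow> real) \<Rightarrow> bool"
  where "complete_algebra_norm_on smul D N \<longleftrightarrow>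
    (\<forall>x\<in>D. 0 \<le> N x \<and> (N x = 0 \<longleftrightarrow> x = 0)) \<and>
    (\<forall>x\<in>D. \<forall>y\<in>D. N (x + y) \<le> N x + N y) \<and>
    (\<forall>c. \<forall>x\<in>D. N (smul c x) = norm c * N x) \<and>
    (\<forall>x\<in>D. \<forall>y\<in>D. N (x * y) \<le> N x * N y) \<and>
    (\<forall>\<sigma>::nat \<Rightarrow> 'a. range \<sigma> \<subseteq> D \<and> (\<forall>\<epsilon>>0. \<exists>n0. \<forall>m\<ge>n0. \<forall>n\<ge>n0. N (\<sigma> m - \<sigma> n) < \<epsilon>) \<longrightarrow>
      (\<exists>l\<in>D. (\<lambda>n. N (\<sigma> n - l)) \<longlonglongrightarrow> 0))"

definition continuously_included :: "'a::real_normed_vector set \<Rightarrow> ('a \<Rightarrow> real) \<Rightarrow> bool"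
  where "continuously_included D N \<longleftrightarrow> (\<exists>C. \<forall>d\<in>D. norm d \<le> C * N d)"

text \<open>
  A net is a family \<open>e\<close> together with a proper filter \<open>\<F>\<close> on its index type; for a directed
  index set \<open>\<F>\<close> is the filter of tails.
\<close>

definition bounded_approximate_identity ::
  "'a::ring set \<Rightarrow> ('a \<Rightarrow> real) \<Rightarrow> ('i \<Rightarrow> 'a) \<Rightarrow> 'i filter \<Rightarrow> bool"
  where "bounded_approximate_identity D N e \<F> \<longleftrightarrow>
    \<F> \<noteq> bot \<and> range e \<subseteq> D \<and> (\<exists>M. \<forall>i. N (e i) \<le> M) \<and>
    (\<forall>d\<in>D. ((\<lambda>i. N (e i * d - d)) \<longlongrightarrow> 0) \<F> \<and> ((\<lambda>i. N (d * e i - d)) \<longlongrightarrow> 0) \<F>)"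

end

theory Submission imports Defs begin

text \<open>
  Fix \<open>a\<close> in the algebra and let \<open>e\<close> be the bounded approximate identity of \<open>D\<close>. Weak
  compactness of multiplication by \<open>a\<close> gives the bounded net \<open>a * e i\<close> a weak cluster point
  \<open>x\<close>. Multiplying by \<open>d \<in> D\<close> is weakly continuous and \<open>a * e i * d\<close> tends to \<open>a * d\<close>,
  so \<open>x * d = a * d\<close> for every \<open>d \<in> D\<close>, and \<open>x = a\<close> because \<open>D\<close> is essential. Hence \<open>a\<close>
  lies in the weak closure of \<open>D\<close>, and it remains to see that \<open>D\<close> is weakly closed.

  The Hahn-Banach theorem (\<open>closed_subspace_separation\<close>) reduces this to norm closedness. Two
  points need care: \<open>D\<close> is complete only for its own norm \<open>N\<close>, and \<open>N\<close> is not assumed to be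
  dominated by the ambient norm. The domination comes from the approximate identity. By two
  closed graph arguments, \<open>N (a * d) \<le> K * norm a * N d\<close> for all \<open>a\<close> and all \<open>d \<in> D\<close>
  (\<open>left_ideal_multiplication_bounded\<close>); then for \<open>d \<in> D\<close>, from \<open>N (e i) \<le> M\<close>,
  the bound \<open>N (d * e i) \<le> K * norm d * M\<close> passes to the limit and gives
  \<open>N d \<le> K * M * norm d\<close>. The two norms are therefore equivalent on \<open>D\<close>, so \<open>D\<close> is closed.

  Both closed graph arguments are instances of Zabreiko's lemma
  (\<open>countably_subadditive_bounded\<close>): a countably subadditive seminorm on a Banach space is
  bounded. It also absorbs the uniform boundedness principle, because a pointwise finite
  supremum of countably subadditive seminorms is again countably subadditive.
\<close>

section \<open>Separation of a point from a closed subspace\<close>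

definition sublinear :: "('v::real_vector \<Rightarrow> real) \<Rightarrow> bool"
  where "sublinear p \<longleftrightarrow>
    (\<forall>x y. p (x + y) \<le> p x + p y) \<and> (\<forall>r\<ge>0. \<forall>x. p (r *\<^sub>R x) = r * p x)"

lemma sublinear_subadd: "sublinear p \<Longrightarrow> p (x + y) \<le> p x + p y"
  by (simp add: sublinear_def)

lemma sublinear_scale: "sublinear p \<Longrightarrow> 0 \<le> r \<Longrightarrow> p (r *\<^sub>R x) = r * p x"
  by (simp add: sublinear_def)

lemma sublinear_zero: "sublinear p \<Longrightarrow> p 0 = 0"
  using sublinear_scale [of p 0 0] by simp

lemma sublinear_minus: "sublinear p \<Longrightarrow> - p (- x) \<le> p x"
  using sublinear_subadd [of p x "- x"] sublinear_zero [of p] by simp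

lemma sublinearI:
  assumes "\<And>x y. p (x + y) \<le> p x + p y" and "p 0 = 0"
    and le: "\<And>r x. 0 < r \<Longrightarrow> p (r *\<^sub>R x) \<le> r * p x"
  shows "sublinear p"
proof -
  have "p (r *\<^sub>R x) = r * p x" if "0 < r" for r x
  proof (rule antisym [OF le [OF that]])
    show "r * p x \<le> p (r *\<^sub>R x)"
      using le [of "inverse r" "r *\<^sub>R x"] that by (simp add: field_simps)
  qed
  with assms show ?thesis
    by (auto simp: sublinear_def le_less)
qed

text \<open>
  Each of the three sublinear functionals built below (a tilted functional, the infimum of a
  chain, the distance to a subspace) is an infimum over a family in which sums and positive
  multiples of values again dominate values; such an infimum is sublinear.
\<close>

lemma cINF_sublinear:
  fixes q :: "'i \<Rightarrow> 'v::real_vector \<Rightarrow> real"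
  assumes I: "I \<noteq> {}" and bdd: "\<And>x. bdd_below ((\<lambda>i. q i x) ` I)"
    and zero: "\<And>i. i \<in> I \<Longrightarrow> 0 \<le> q i 0" "\<exists>i\<in>I. q i 0 \<le> 0"
    and add: "\<And>i j x y. i \<in> I \<Longrightarrow> j \<in> I \<Longrightarrow> \<exists>k\<in>I. q k (x + y) \<le> q i x + q j y"
    and scale: "\<And>i r x. i \<in> I \<Longrightarrow> 0 < r \<Longrightarrow> \<exists>k\<in>I. q k (r *\<^sub>R x) \<le> r * q i x"
  shows "sublinear (\<lambda>x. INF i\<in>I. q i x)"
proof (rule sublinearI)
  let ?u = "\<lambda>x. INF i\<in>I. q i x"
  have lower: "?u x \<le> q i x" if "i \<in> I" for i x
    using cINF_lower [OF bdd that] .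
  show "?u (x + y) \<le> ?u x + ?u y" for x y
  proof -
    have "?u (x + y) - q j y \<le> ?u x" if j: "j \<in> I" for j
    proof (rule cINF_greatest [OF I])
      fix i assume "i \<in> I"
      then obtain k where "k \<in> I" "q k (x + y) \<le> q i x + q j y"
        using add j by blast
      then show "?u (x + y) - q j y \<le> q i x"
        using lower [of k "x + y"] by linarith
    qed
    then have "?u (x + y) - ?u x \<le> ?u y"
      by (intro cINF_greatest [OF I]) (simp add: algebra_simps)
    then show ?thesis by simp
  qed
  show "?u 0 = 0"
  proof (rule antisym)
    show "?u 0 \<le> 0" using zero(2) lower [of _ 0] order_trans by blast
    show "0 \<le> ?u 0" by (intro cINF_greatest [OF I] zero(1))
  qed
  show "?u (r *\<^sub>R x) \<le> r * ?u x" if r: "0 < r" for r x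
  proof -
    have "?u (r *\<^sub>R x) / r \<le> ?u x"
    proof (rule cINF_greatest [OF I])
      fix i assume "i \<in> I"
      then obtain k where "k \<in> I" "q k (r *\<^sub>R x) \<le> r * q i x"
        using scale r by blast
      then show "?u (r *\<^sub>R x) / r \<le> q i x"
        using lower [of k "r *\<^sub>R x"] r by (simp add: field_simps)
    qed
    then show ?thesis using r by (simp add: field_simps)
  qed
qed

text \<open>
  The functional \<open>q' x = INF t\<ge>0. q (x + t a) - t q a\<close> lies below \<open>q\<close> and satisfies
  \<open>q' (- a) \<le> - q a\<close>. A sublinear functional that has no other one below it must
  therefore be odd, hence linear; and starting from \<open>q'\<close> instead of \<open>q\<close> forces a linear
  functional below to attain the value \<open>q a\<close> at \<open>a\<close>.
\<close>

lemma sublinear_tilt: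
  assumes q: "sublinear q"
  obtains q' where "sublinear q'" "q' \<le> q" "q' (- a) \<le> - q a"
proof
  define h where "h t x = q (x + t *\<^sub>R a) - t * q a" for t x
  let ?q' = "\<lambda>x. INF t\<in>{0..}. h t x"
  have bdd: "bdd_below ((\<lambda>t. h t x) ` {0..})" for x
  proof
    fix y assume "y \<in> (\<lambda>t. h t x) ` {0..}"
    then obtain t where t: "0 \<le> t" "y = h t x" by auto
    have "t * q a = q ((x + t *\<^sub>R a) + (- x))"
      using sublinear_scale [OF q \<open>0 \<le> t\<close>, of a] by simp
    also have "\<dots> \<le> q (x + t *\<^sub>R a) + q (- x)"
      by (rule sublinear_subadd [OF q])
    finally show "- q (- x) \<le> y"
      using t by (simp add: h_def)
  qed
  show "sublinear ?q'"
  proof (rule cINF_sublinear)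
    show "{0::real..} \<noteq> {}" by auto
    show "bdd_below ((\<lambda>t. h t x) ` {0..})" for x by (rule bdd)
    show "0 \<le> h t 0" if "t \<in> {0..}" for t
      using that sublinear_scale [OF q] by (simp add: h_def)
    show "\<exists>t\<in>{0..}. h t 0 \<le> 0"
      using sublinear_zero [OF q] by (intro bexI [of _ 0]) (simp_all add: h_def)
    show "\<exists>k\<in>{0..}. h k (x + y) \<le> h s x + h t y" if "s \<in> {0..}" "t \<in> {0..}" for s t x y
    proof
      show "s + t \<in> {0..}" using that by simp
      show "h (s + t) (x + y) \<le> h s x + h t y"
        using sublinear_subadd [OF q, of "x + s *\<^sub>R a" "y + t *\<^sub>R a"]
        by (simp add: h_def algebra_simps)
    qed
    show "\<exists>k\<in>{0..}. h k (r *\<^sub>R x) \<le> r * h t x" if "t \<in> {0..}" "0 < r" for t r x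
    proof
      show "r * t \<in> {0..}" using that by simp
      show "h (r * t) (r *\<^sub>R x) \<le> r * h t x"
        using sublinear_scale [OF q, of r "x + t *\<^sub>R a"] that
        by (simp add: h_def algebra_simps)
    qed
  qed
  show "?q' \<le> q"
  proof (rule le_funI)
    fix x
    show "?q' x \<le> q x"
      using cINF_lower [OF bdd, of 0 x] by (simp add: h_def)
  qed
  show "?q' (- a) \<le> - q a"
    using cINF_lower [OF bdd, of 1 "- a"] sublinear_zero [OF q] by (simp add: h_def)
qed

lemma minimal_sublinear_exists:
  assumes p: "sublinear p"
  obtains m where "sublinear m" "m \<le> p" "\<And>q. sublinear q \<Longrightarrow> q \<le> m \<Longrightarrow> q = m"
proof -
  define A where "A = {q. sublinear q \<and> q \<le> p}"
  have "\<exists>m\<in>A. \<forall>q\<in>A. m \<ge> q \<longrightarrow> q = m"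
  proof (rule predicate_Zorn)
    show "partial_order_on A (relation_of (\<ge>) A)"
      by (rule partial_order_on_relation_ofI) auto
    fix C assume C: "C \<in> Chains (relation_of (\<ge>) A)"
    have CA: "C \<subseteq> A"
      using Chains_relation_of C by blast
    show "\<exists>u\<in>A. \<forall>q\<in>C. q \<ge> u"
    proof (cases "C = {}")
      case True
      then show ?thesis using p by (auto simp: A_def)
    next
      case False
      let ?u = "\<lambda>x. INF q\<in>C. q x"
      have sub: "sublinear q" and le: "q x \<le> p x" if "q \<in> C" for q x
        using CA that by (auto simp: A_def le_fun_def)
      have bdd: "bdd_below ((\<lambda>q. q x) ` C)" for x
      proof
        fix y assume "y \<in> (\<lambda>q. q x) ` C"
        then obtain q where q: "q \<in> C" "y = q x" by blast
        show "- p (- x) \<le> y"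
          using sublinear_minus [OF sub [OF q(1)], of x] le [OF q(1), of "- x"] q(2) by simp
      qed
      have lower: "?u x \<le> q x" if "q \<in> C" for q x
        using cINF_lower [OF bdd that] .
      have "sublinear ?u"
      proof (rule cINF_sublinear [OF False bdd])
        show "0 \<le> q 0" if "q \<in> C" for q
          using sublinear_zero [OF sub [OF that]] by simp
        show "\<exists>q\<in>C. q 0 \<le> 0"
          using False sublinear_zero [OF sub] by fastforce
        show "\<exists>k\<in>C. k (x + y) \<le> q x + r y" if "q \<in> C" "r \<in> C" for q r x y
        proof -
          have "q \<le> r \<or> r \<le> q"
            using C that by (auto simp: Chains_def relation_of_def)
          then show ?thesis
          proof
            assume "q \<le> r"
            then have "q (x + y) \<le> q x + r y"
              using sublinear_subadd [OF sub [OF that(1)], of x y] le_funD [of q r y] by simp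
            then show ?thesis using that by blast
          next
            assume "r \<le> q"
            then have "r (x + y) \<le> q x + r y"
              using sublinear_subadd [OF sub [OF that(2)], of x y] le_funD [of r q x] by simp
            then show ?thesis using that by blast
          qed
        qed
        show "\<exists>k\<in>C. k (r *\<^sub>R x) \<le> r * q x" if "q \<in> C" "0 < r" for q r x
          using sublinear_scale [OF sub [OF that(1)], of r x] that
          by (intro bexI [of _ q]) simp_all
      qed
      moreover have "?u \<le> p"
      proof (rule le_funI)
        fix x
        obtain q where "q \<in> C" using False by blast
        then show "?u x \<le> p x"
          using lower le order_trans by blast
      qed
      ultimately show ?thesis
        using lower by (intro bexI [of _ ?u]) (auto simp: A_def le_fun_def)
    qed
  qed
  then show ?thesis
    using that unfolding A_def by (metis (mono_tags, lifting) mem_Collect_eq order_trans)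
qed

text \<open>
  Linear functionals are exactly the minimal sublinear ones, so Zorn's lemma is applied to total
  sublinear functionals rather than to partial linear ones.
\<close>

theorem Hahn_Banach_sublinear:
  assumes p: "sublinear p"
  obtains u where "linear u" "\<And>x. u x \<le> p x" "u a = p a"
proof -
  obtain p' where p': "sublinear p'" "p' \<le> p" "p' (- a) \<le> - p a"
    using sublinear_tilt [OF p] by blast
  obtain m where m: "sublinear m" "m \<le> p'"
    and minimal: "\<And>q. sublinear q \<Longrightarrow> q \<le> m \<Longrightarrow> q = m"
    using minimal_sublinear_exists [OF p'(1)] by blast
  \<comment> \<open>Tilting cannot lower a minimal functional.\<close>
  have odd: "m (- x) = - m x" for x
  proof -
    obtain q where "sublinear q" "q \<le> m" "q (- x) \<le> - m x"
      using sublinear_tilt [OF m(1)] by blast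
    with minimal [of q] sublinear_minus [OF m(1), of "- x"] show ?thesis
      by simp
  qed
  have "linear m"
  proof (rule linearI)
    show "m (x + y) = m x + m y" for x y
      using sublinear_subadd [OF m(1), of x y] sublinear_subadd [OF m(1), of "- x" "- y"]
        odd [of x] odd [of y] odd [of "x + y"] by simp
    show "m (r *\<^sub>R x) = r *\<^sub>R m x" for r x
    proof (cases "0 \<le> r")
      case True
      then show ?thesis by (simp add: sublinear_scale [OF m(1)])
    next
      case False
      then show ?thesis
        using sublinear_scale [OF m(1), of "- r" x] odd [of "r *\<^sub>R x"] by simp
    qed
  qed
  moreover have "m x \<le> p x" for x
    using m(2) p'(2) by (meson le_funD order_trans)
  moreover have "m a = p a"
    using odd [of a] le_funD [OF m(2), of "- a"] p'(3) calculation(2) [of a] by simp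
  ultimately show ?thesis using that by blast
qed

lemma sublinear_infdist:
  fixes W :: "'v::real_normed_vector set"
  assumes W: "subspace W"
  shows "sublinear (\<lambda>x. infdist x W)"
proof -
  have "W \<noteq> {}" using subspace_0 [OF W] by blast
  then have eq: "(\<lambda>x. infdist x W) = (\<lambda>x. INF w\<in>W. dist x w)"
    by (simp add: infdist_notempty)
  show ?thesis
    unfolding eq
  proof (rule cINF_sublinear [OF \<open>W \<noteq> {}\<close>])
    show "bdd_below ((\<lambda>w. dist x w) ` W)" for x
      by (rule bdd_belowI2 [of _ 0]) simp
    show "\<exists>w\<in>W. dist 0 w \<le> 0"
      using subspace_0 [OF W] by force
    show "\<exists>k\<in>W. dist (x + y) k \<le> dist x v + dist y w" if "v \<in> W" "w \<in> W" for v w x y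
      using subspace_add [OF W that] dist_triangle_add by blast
    show "\<exists>k\<in>W. dist (r *\<^sub>R x) k \<le> r * dist x w" if "w \<in> W" "0 < r" for w r x
      using subspace_scale [OF W that(1), of r] that(2)
      by (intro bexI [of _ "r *\<^sub>R w"]) (simp_all add: dist_norm flip: scaleR_diff_right)
  qed simp
qed

text \<open>
  A linear functional dominated by the distance to \<open>W\<close> is bounded by the norm and vanishes on
  \<open>W\<close>; its value at \<open>a\<close> can be taken to be the distance itself, which is positive.
\<close>

lemma closed_subspace_separation_real:
  fixes W :: "'v::real_normed_vector set"
  assumes W: "subspace W" "closed W" and a: "a \<notin> W"
  obtains u where "bounded_linear u" "\<And>w. w \<in> W \<Longrightarrow> u w = 0" "u a \<noteq> (0::real)"
proof -
  have ne: "W \<noteq> {}" "0 \<in> W" using subspace_0 [OF W(1)] by auto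
  obtain u where u: "linear u" "\<And>x. u x \<le> infdist x W" "u a = infdist a W"
    using Hahn_Banach_sublinear [OF sublinear_infdist [OF W(1)]] by blast
  have minus: "u (- x) = - u x" for x
    using linear_neg [OF u(1)] .
  have "u x \<le> norm x" for x
    using u(2) [of x] infdist_le [OF ne(2), of x] by simp
  from this this [of "- x" for x] have "\<bar>u x\<bar> \<le> norm x" for x
    by (simp add: minus abs_le_iff)
  then have "bounded_linear u"
    using u(1) by (intro bounded_linear_intro [where K = 1]) (simp_all add: linear_add linear_scale)
  moreover have "u w = 0" if "w \<in> W" for w
    using u(2) [of w] u(2) [of "- w"] that subspace_neg [OF W(1) that] by (simp add: minus)
  moreover have "u a \<noteq> 0"
    using u(3) infdist_pos_not_in_closed [OF W(2) ne(1) a] by simp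
  ultimately show ?thesis using that by blast
qed

context banach_algebra_over
begin

lemma scale_scaleR: "smul c (r *\<^sub>R x) = r *\<^sub>R smul c x"
  by (metis scale_of_real scale_left_commute)

lemma bounded_linear_smul: "bounded_linear (smul c)"
  by (rule bounded_linear_intro [where K = "norm c"])
    (simp_all add: scale_right_distrib scale_scaleR norm_scale mult.commute)

lemma subspace_imp_real_subspace:
  assumes "subspace W" shows "Real_Vector_Spaces.subspace W"
  using assms unfolding subspace_def real_vector.subspace_def
  by (metis scale_of_real)

text \<open>
  For \<open>\<complex>\<close> this is the usual passage from a real functional to the complex functional having it
  as real part. In general, the real bilinear form \<open>(c * z) \<bullet> 1\<close> on the field \<open>'k\<close> is
  nondegenerate since \<open>(inverse z * z) \<bullet> 1 \<noteq> 0\<close>. As \<open>'k\<close> has finite real dimension, every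
  real-linear functional on it is \<open>c \<mapsto> (c * z) \<bullet> 1\<close> for a unique \<open>z\<close>. Applied to
  \<open>c \<mapsto> u (c x)\<close>, this defines \<open>f x\<close>, and uniqueness makes \<open>f\<close> linear over \<open>'k\<close>.
\<close>

lemma real_functional_lifts:
  fixes u :: "'a \<Rightarrow> real"
  assumes u: "bounded_linear u"
  obtains f where "f \<in> dual_space smul" "\<And>x. f x \<bullet> 1 = u x"
    "\<And>x. (\<And>c. u (smul c x) = 0) \<Longrightarrow> f x = 0"
proof -
  interpret u: bounded_linear u by (rule u)
  have nondeg: "z = 0" if "\<And>c. (c * z) \<bullet> (1::'k) = 0" for z :: 'k
    using that [of "inverse z"] by (cases "z = 0") auto
  \<comment> \<open>\<open>S\<close> and \<open>h\<close> encode the functionals \<open>c \<mapsto> (c * z) \<bullet> 1\<close> and \<open>c \<mapsto> u (c x)\<close> by their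
    values on the basis; \<open>f\<close> is then \<open>h\<close> followed by the inverse of \<open>S\<close>.\<close>
  define S :: "'k \<Rightarrow> 'k" where "S z = (\<Sum>b\<in>Basis. ((b * z) \<bullet> 1) *\<^sub>R b)" for z
  define h :: "'a \<Rightarrow> 'k" where "h x = (\<Sum>b\<in>Basis. u (smul b x) *\<^sub>R b)" for x
  have S_lin: "linear S"
    unfolding S_def
    by (rule linearI) (simp_all add: algebra_simps inner_add_left sum.distrib scaleR_sum_right)
  have expand: "P c = Q c" if "linear P" "linear Q" "\<And>b. b \<in> Basis \<Longrightarrow> P b = Q b"
    for P Q :: "'k \<Rightarrow> real" and c
    using linear_eq_on_span [of P Q Basis c] that by simp
  have lin_form: "linear (\<lambda>c. (c * z) \<bullet> (1::'k))" for z
    by (rule linearI) (simp_all add: algebra_simps inner_add_left)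
  have lin_u: "linear (\<lambda>c. u (smul c x))" for x
  proof (rule linearI)
    show "u (smul (r *\<^sub>R c) x) = r *\<^sub>R u (smul c x)" for r c
      by (simp add: scaleR_conv_of_real [of r c] scale_of_real u.scaleR flip: scale_scale)
  qed (simp add: scale_left_distrib u.add)
  have S_inner: "S z \<bullet> b = (b * z) \<bullet> 1" if "b \<in> Basis" for z b
    using that by (simp add: S_def)
  have h_inner: "h x \<bullet> b = u (smul b x)" if "b \<in> Basis" for x b
    using that by (simp add: h_def)
  have "inj S"
  proof (subst linear_injective_0 [OF S_lin], intro allI impI)
    fix z assume "S z = 0"
    then have "(b * z) \<bullet> 1 = 0" if "b \<in> Basis" for b
      using S_inner [OF that, of z] by simp
    then have "(c * z) \<bullet> 1 = 0" for c
      using expand [OF lin_form [of z] linear_zero] by simp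
    then show "z = 0" by (rule nondeg)
  qed
  then obtain g where g: "linear g" "\<And>x. S (g x) = x"
    using linear_injective_isomorphism [OF S_lin] by blast
  define f where "f x = g (h x)" for x
  have f: "(c * f x) \<bullet> 1 = u (smul c x)" for c x
  proof (rule expand [OF lin_form lin_u])
    fix b :: 'k assume "b \<in> Basis"
    then show "(b * f x) \<bullet> 1 = u (smul b x)"
      using S_inner [of b "f x"] h_inner [of b x] by (simp add: f_def g)
  qed
  have "bounded_linear h"
    unfolding h_def
    by (intro bounded_linear_sum bounded_linear_scaleR_left [THEN bounded_linear_compose]
        bounded_linear_compose [OF u bounded_linear_smul])
  then have "bounded_linear f"
    unfolding f_def using g(1) by (auto intro: bounded_linear_compose simp: linear_conv_bounded_linear)
  moreover have "f (smul d x) = d * f x" for d x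
  proof -
    have "(c * (f (smul d x) - d * f x)) \<bullet> 1 = 0" for c
      using f [of c "smul d x"] f [of "c * d" x]
      by (simp add: algebra_simps inner_diff_left)
    then have "f (smul d x) - d * f x = 0" by (rule nondeg)
    then show ?thesis by simp
  qed
  ultimately have "f \<in> dual_space smul"
    by (simp add: dual_space_def)
  moreover have "f x \<bullet> 1 = u x" for x
    using f [of 1 x] by simp
  moreover have "f x = 0" if "\<And>c. u (smul c x) = 0" for x
    by (rule nondeg) (simp add: f that)
  ultimately show ?thesis using that by blast
qed

lemma closed_subspace_separation:
  assumes W: "subspace W" "closed W" and a: "a \<notin> W"
  obtains f where "f \<in> dual_space smul" "\<And>w. w \<in> W \<Longrightarrow> f w = 0" "f a \<noteq> 0"
proof -
  obtain u where u: "bounded_linear u" "\<And>w. w \<in> W \<Longrightarrow> u w = 0" "u a \<noteq> (0::real)"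
    using closed_subspace_separation_real [OF subspace_imp_real_subspace [OF W(1)] W(2) a] by blast
  obtain f where f: "f \<in> dual_space smul" "\<And>x. f x \<bullet> 1 = u x"
    "\<And>x. (\<And>c. u (smul c x) = 0) \<Longrightarrow> f x = 0"
    using real_functional_lifts [OF u(1)] by blast
  show ?thesis
  proof
    show "f \<in> dual_space smul" by (rule f)
    show "f w = 0" if "w \<in> W" for w
      using that u(2) subspace_scale [OF W(1)] by (intro f(3)) blast
    show "f a \<noteq> 0" using f(2) [of a] u(3) by auto
  qed
qed

lemma dual_space_separates_points:
  assumes "\<And>f. f \<in> dual_space smul \<Longrightarrow> f x = f y"
  shows "x = y"
proof (rule ccontr)
  assume "x \<noteq> y"
  then have "x - y \<notin> {0}" by simp
  then obtain f where f: "f \<in> dual_space smul" "f (x - y) \<noteq> 0"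
    using closed_subspace_separation [OF subspace_single_0] by blast
  then have "f (x - y) = f x - f y"
    by (auto simp: dual_space_def linear_simps)
  with f assms show False by simp
qed

end
section \<open>Zabreiko's lemma\<close>

text \<open>
  The norm lives on a subspace of an ambient vector space and is not tied to a type class, so
  that the results apply both to a Banach space and to an ideal with a norm of its own.
\<close>

locale complete_norm =
  fixes S :: "'v::real_vector set" and N :: "'v \<Rightarrow> real"
  assumes subspace: "subspace S"
    and nonneg: "x \<in> S \<Longrightarrow> 0 \<le> N x"
    and eq_0: "x \<in> S \<Longrightarrow> N x = 0 \<longleftrightarrow> x = 0"
    and triangle: "x \<in> S \<Longrightarrow> y \<in> S \<Longrightarrow> N (x + y) \<le> N x + N y"
    and scale: "x \<in> S \<Longrightarrow> N (r *\<^sub>R x) = \<bar>r\<bar> * N x"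
    and complete: "range \<sigma> \<subseteq> S \<Longrightarrow>
      (\<And>\<epsilon>. 0 < \<epsilon> \<Longrightarrow> \<exists>n0. \<forall>m\<ge>n0. \<forall>n\<ge>n0. N (\<sigma> m - \<sigma> n) < \<epsilon>) \<Longrightarrow>
      \<exists>l\<in>S. (\<lambda>n. N (\<sigma> n - l)) \<longlonglongrightarrow> 0"
begin

lemmas mem_0 = subspace_0 [OF subspace]
  and mem_add = subspace_add [OF subspace]
  and mem_diff = subspace_diff [OF subspace]
  and mem_scale = subspace_scale [OF subspace]
  and mem_sum = subspace_sum [OF subspace]

lemma minus_commute: "x \<in> S \<Longrightarrow> y \<in> S \<Longrightarrow> N (x - y) = N (y - x)"
  using scale [of "x - y" "-1"] by (simp add: mem_diff)

lemma triangle_diff: "x \<in> S \<Longrightarrow> y \<in> S \<Longrightarrow> N (x - y) \<le> N x + N y"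
  using triangle [of x "-1 *\<^sub>R y"] scale [of y "-1"] mem_scale [of y "-1"] by simp

lemma norm_sum_le: "finite I \<Longrightarrow> (\<And>i. i \<in> I \<Longrightarrow> x i \<in> S) \<Longrightarrow> N (sum x I) \<le> (\<Sum>i\<in>I. N (x i))"
proof (induction I rule: finite_induct)
  case empty
  then show ?case using eq_0 [of 0] mem_0 by simp
next
  case (insert i I)
  then have "N (x i + sum x I) \<le> N (x i) + N (sum x I)"
    by (intro triangle mem_sum) auto
  with insert show ?case by simp
qed

lemma summable_imp_convergent:
  assumes x: "\<And>n. x n \<in> S" and sum: "summable (\<lambda>n. N (x n))"
  obtains l where "l \<in> S" "(\<lambda>n. N ((\<Sum>i<n. x i) - l)) \<longlonglongrightarrow> 0" "N l \<le> (\<Sum>n. N (x n))"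
proof -
  let ?\<sigma> = "\<lambda>n. \<Sum>i<n. x i"
  have mem: "?\<sigma> n \<in> S" for n by (intro mem_sum x)
  have small: "N (?\<sigma> m - ?\<sigma> n) \<le> norm (\<Sum>i=n..<m. N (x i))" if "n \<le> m" for m n
  proof -
    have "?\<sigma> m - ?\<sigma> n = (\<Sum>i=n..<m. x i)"
      using that by (simp add: sum_diff_nat_ivl flip: atLeast0LessThan)
    then show ?thesis
      using norm_sum_le [of "{n..<m}" x] x by (simp add: order_trans [OF _ abs_ge_self])
  qed
  have "\<exists>n0. \<forall>m\<ge>n0. \<forall>n\<ge>n0. N (?\<sigma> m - ?\<sigma> n) < \<epsilon>" if "0 < \<epsilon>" for \<epsilon>
  proof -
    obtain n0 where n0: "\<And>m n. n0 \<le> m \<Longrightarrow> norm (\<Sum>i=m..<n. N (x i)) < \<epsilon>"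
      using sum \<open>0 < \<epsilon>\<close> unfolding summable_Cauchy by blast
    have "N (?\<sigma> m - ?\<sigma> n) < \<epsilon>" if "n0 \<le> m" "n0 \<le> n" for m n
    proof (cases "n \<le> m")
      case True
      then show ?thesis using small n0 that le_less_trans by blast
    next
      case False
      then have "N (?\<sigma> n - ?\<sigma> m) < \<epsilon>"
        using small [of m n] n0 [of m n] that by simp
      then show ?thesis by (simp add: minus_commute [OF mem mem])
    qed
    then show ?thesis by blast
  qed
  then obtain l where l: "l \<in> S" "(\<lambda>n. N (?\<sigma> n - l)) \<longlonglongrightarrow> 0"
    using complete [of ?\<sigma>] mem by blast
  have "N l - (\<Sum>n. N (x n)) \<le> N (?\<sigma> n - l)" for n
  proof -
    have "N l \<le> N (?\<sigma> n) + N (?\<sigma> n - l)"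
      using triangle_diff [of "?\<sigma> n" "?\<sigma> n - l"] mem l(1) by (simp add: mem_diff)
    also have "N (?\<sigma> n) \<le> (\<Sum>i<n. N (x i))"
      by (rule norm_sum_le) (simp_all add: x)
    also have "(\<Sum>i<n. N (x i)) \<le> (\<Sum>n. N (x n))"
      by (rule sum_le_suminf [OF sum]) (simp_all add: x nonneg)
    finally show ?thesis by simp
  qed
  then have "N l - (\<Sum>n. N (x n)) \<le> 0"
    by (intro LIMSEQ_le_const [OF l(2)]) blast
  with l that show ?thesis by simp
qed

text \<open>
  Baire's category theorem for the metric \<open>N (x - y)\<close> on \<open>S\<close>: one of countably many sets
  covering \<open>S\<close> is dense in some ball.
\<close>

lemma Baire_closure_ball:
  assumes cover: "S = (\<Union>n::nat. F n)"
  obtains n x0 r where "x0 \<in> S" "0 < r"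
    "\<And>y \<epsilon>. y \<in> S \<Longrightarrow> N (y - x0) < r \<Longrightarrow> 0 < \<epsilon> \<Longrightarrow> \<exists>z\<in>F n. N (y - z) < \<epsilon>"
proof -
  \<comment> \<open>A metric has to be nonnegative and symmetric at all pairs, whence the value 0 outside \<open>S\<close>.\<close>
  define d where "d x y = (if x \<in> S \<and> y \<in> S then N (x - y) else 0)" for x y
  interpret M: Metric_space S d
  proof
    show "0 \<le> d x y" for x y by (simp add: d_def nonneg mem_diff)
    show "d x y = d y x" for x y by (simp add: d_def minus_commute)
    show "d x y = 0 \<longleftrightarrow> x = y" if "x \<in> S" "y \<in> S" for x y
      using that by (simp add: d_def eq_0 mem_diff)
    show "d x z \<le> d x y + d y z" if "x \<in> S" "y \<in> S" "z \<in> S" for x y z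
      using triangle [of "x - y" "y - z"] that by (simp add: d_def mem_diff)
  qed
  have "M.mcomplete"
    unfolding M.mcomplete_def
  proof (intro allI impI)
    fix \<sigma> assume \<sigma>: "M.MCauchy \<sigma>"
    then have mem: "range \<sigma> \<subseteq> S" by (simp add: M.MCauchy_def)
    have "\<exists>n0. \<forall>m\<ge>n0. \<forall>n\<ge>n0. N (\<sigma> m - \<sigma> n) < \<epsilon>" if "0 < \<epsilon>" for \<epsilon>
    proof -
      have "d (\<sigma> m) (\<sigma> n) = N (\<sigma> m - \<sigma> n)" for m n
        using mem by (auto simp: d_def)
      then show ?thesis using \<sigma> that by (simp add: M.MCauchy_def)
    qed
    then obtain l where l: "l \<in> S" "(\<lambda>n. N (\<sigma> n - l)) \<longlonglongrightarrow> 0"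
      using complete [OF mem] by blast
    have "d (\<sigma> n) l = N (\<sigma> n - l)" for n
      using mem l(1) by (auto simp: d_def)
    moreover have "\<sigma> n \<in> S" for n
      using mem by blast
    ultimately have "limitin M.mtopology \<sigma> l sequentially"
      using l by (subst M.limitin_metric_dist_null) auto
    then show "\<exists>x. limitin M.mtopology \<sigma> x sequentially" by blast
  qed
  have "\<exists>n. M.mtopology interior_of (M.mtopology closure_of F n) \<noteq> {}"
  proof (rule ccontr)
    assume "\<not> ?thesis"
    then have "M.mtopology interior_of (\<Union>n. M.mtopology closure_of F n) = {}"
      by (intro M.metric_Baire_category_alt [OF \<open>M.mcomplete\<close>]) auto
    moreover have "(\<Union>n. M.mtopology closure_of F n) = S"
    proof
      show "(\<Union>n. M.mtopology closure_of F n) \<subseteq> S"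
        using closure_of_subset_topspace [of M.mtopology] by auto
      have "F n \<subseteq> S" for n
        using cover by blast
      then have "F n \<subseteq> M.mtopology closure_of F n" for n
        by (simp add: closure_of_subset)
      then show "S \<subseteq> (\<Union>n. M.mtopology closure_of F n)"
        using cover by blast
    qed
    ultimately show False
      using interior_of_topspace [of M.mtopology] mem_0 by auto
  qed
  then obtain n x0 where x0: "x0 \<in> M.mtopology interior_of (M.mtopology closure_of F n)"
    by blast
  then obtain r where r: "0 < r" "M.mball x0 r \<subseteq> M.mtopology interior_of (M.mtopology closure_of F n)"
    using M.openin_mtopology openin_interior_of by metis
  have "x0 \<in> S"
    using x0 interior_of_subset_topspace [of M.mtopology] by auto
  show ?thesis
  proof
    fix y \<epsilon> assume y: "y \<in> S" "N (y - x0) < r" and "0 < (\<epsilon>::real)"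
    then have "y \<in> M.mball x0 r"
      using \<open>x0 \<in> S\<close> by (simp add: d_def minus_commute)
    then have "y \<in> M.mtopology closure_of F n"
      using r(2) interior_of_subset [of M.mtopology "M.mtopology closure_of F n"] by blast
    then show "\<exists>z\<in>F n. N (y - z) < \<epsilon>"
      using \<open>0 < \<epsilon>\<close> \<open>y \<in> S\<close> unfolding M.metric_closure_of by (force simp: d_def)
  qed fact+
qed

text \<open>
  Zabreiko's lemma. The sets \<open>{x. p x \<le> n}\<close> cover \<open>S\<close>, so one of them is dense in a ball, and
  differences of its elements are dense in a ball around 0. By homogeneity every \<open>h\<close> is
  approximated, up to half its norm, by some \<open>z\<close> with \<open>p z \<le> c * N h\<close>. Approximating the
  error again and again writes \<open>h\<close> as a series whose \<open>p\<close>-values are dominated by a geometric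
  series. This is the argument of the open mapping theorem.
\<close>

theorem countably_subadditive_bounded:
  assumes p_nonneg: "\<And>x. x \<in> S \<Longrightarrow> 0 \<le> p x"
    and p_scale: "\<And>r x. x \<in> S \<Longrightarrow> p (r *\<^sub>R x) = \<bar>r\<bar> * p x"
    and p_subadd: "\<And>x s. \<lbrakk>\<And>n. x n \<in> S; s \<in> S; (\<lambda>n. N ((\<Sum>i<n. x i) - s)) \<longlonglongrightarrow> 0;
      summable (\<lambda>n. p (x n))\<rbrakk> \<Longrightarrow> p s \<le> (\<Sum>n. p (x n))"
  shows "\<exists>K\<ge>0. \<forall>x\<in>S. p x \<le> K * N x"
proof -
  have p0: "p 0 = 0" and N0: "N 0 = 0"
    using p_scale [of 0 0] eq_0 [of 0] mem_0 by auto
  \<comment> \<open>Finite subadditivity is the case of a series with two nonzero terms.\<close>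
  have p_diff: "p (x - y) \<le> p x + p y" if "x \<in> S" "y \<in> S" for x y
  proof -
    define z where "z n = (if n = 0 then x else if n = 1 then -1 *\<^sub>R y else 0)" for n :: nat
    have mem: "z n \<in> S" for n
      using that mem_0 mem_scale [of y "-1"] by (simp add: z_def)
    have "(\<Sum>i<n. z i) = x - y" if "2 \<le> n" for n
    proof -
      have "(\<Sum>i<n. z i) = (\<Sum>i\<in>{0,1}. z i)"
        using that by (intro sum.mono_neutral_right) (auto simp: z_def)
      then show ?thesis by (simp add: z_def)
    qed
    then have "\<forall>\<^sub>F n in sequentially. N ((\<Sum>i<n. z i) - (x - y)) = 0"
      using N0 by (auto intro!: eventually_sequentiallyI [of 2])
    then have lim: "(\<lambda>n. N ((\<Sum>i<n. z i) - (x - y))) \<longlonglongrightarrow> 0"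
      by (rule tendsto_eventually)
    have "(\<lambda>n. p (z n)) sums (\<Sum>n\<in>{0,1}. p (z n))"
      by (rule sums_finite) (auto simp: z_def p0)
    moreover have "(\<Sum>n\<in>{0,1}. p (z n)) = p x + p y"
      using p_scale [OF that(2), of "-1"] by (simp add: z_def)
    ultimately show ?thesis
      using p_subadd [OF mem mem_diff [OF that] lim] by (simp add: sums_iff)
  qed
  have "S = (\<Union>n::nat. {x\<in>S. p x \<le> real n})"
    using real_arch_simple by auto
  then obtain n x0 r where x0: "x0 \<in> S" and r: "0 < r"
    and dense: "\<And>y \<epsilon>. y \<in> S \<Longrightarrow> N (y - x0) < r \<Longrightarrow> 0 < \<epsilon> \<Longrightarrow>
      \<exists>z\<in>{x\<in>S. p x \<le> real n}. N (y - z) < \<epsilon>"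
    using Baire_closure_ball [of "\<lambda>n. {x\<in>S. p x \<le> real n}"] by metis
  have near0: "\<exists>z\<in>S. p z \<le> 2 * real n \<and> N (h - z) < \<epsilon>" if h: "h \<in> S" "N h < r" and "0 < \<epsilon>" for h \<epsilon>
  proof -
    obtain z1 where z1: "z1 \<in> S" "p z1 \<le> real n" "N (x0 + h - z1) < \<epsilon> / 2"
      using dense [of "x0 + h" "\<epsilon> / 2"] h x0 \<open>0 < \<epsilon>\<close> by (auto simp: mem_add)
    obtain z2 where z2: "z2 \<in> S" "p z2 \<le> real n" "N (x0 - z2) < \<epsilon> / 2"
      using dense [of x0 "\<epsilon> / 2"] x0 r N0 \<open>0 < \<epsilon>\<close> by auto
    have "N (h - (z1 - z2)) = N ((x0 + h - z1) - (x0 - z2))"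
      by (simp add: algebra_simps)
    also have "\<dots> \<le> N (x0 + h - z1) + N (x0 - z2)"
      by (intro triangle_diff mem_diff mem_add x0 h z1 z2)
    finally have "N (h - (z1 - z2)) < \<epsilon>" using z1 z2 by simp
    moreover have "p (z1 - z2) \<le> 2 * real n"
      using p_diff [OF z1(1) z2(1)] z1 z2 by simp
    ultimately show ?thesis
      using z1 z2 mem_diff by blast
  qed
  define c where "c = 4 * real n / r"
  have c: "0 \<le> c" using r by (simp add: c_def)
  have approx: "\<exists>z\<in>S. p z \<le> c * N h \<and> N (h - z) \<le> N h / 2" if h: "h \<in> S" for h
  proof (cases "h = 0")
    case True
    then show ?thesis using mem_0 p0 N0 by (intro bexI [of _ 0]) simp_all
  next
    case False
    then have pos: "0 < N h" using nonneg [OF h] eq_0 [OF h] by simp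
    \<comment> \<open>Rescale \<open>h\<close> to norm \<open>r / 2\<close>, inside the ball where approximation is available.\<close>
    define t where "t = r / (2 * N h)"
    have t: "0 < t" using r pos by (simp add: t_def)
    have "N (t *\<^sub>R h) < r"
      using scale [OF h, of t] t pos r by (simp add: t_def)
    then obtain z where z: "z \<in> S" "p z \<le> 2 * real n" "N (t *\<^sub>R h - z) < t * N h / 2"
      using near0 [of "t *\<^sub>R h" "t * N h / 2"] mem_scale [OF h] t pos by auto
    let ?z = "inverse t *\<^sub>R z"
    have "p ?z = inverse t * p z"
      using p_scale [OF z(1)] t by simp
    also have "\<dots> \<le> inverse t * (2 * real n)"
      using z(2) t by simp
    also have "\<dots> = c * N h"
      using r pos by (simp add: c_def t_def field_simps)
    finally have "p ?z \<le> c * N h" .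
    moreover have "h - ?z = inverse t *\<^sub>R (t *\<^sub>R h - z)"
      using t by (simp add: algebra_simps)
    then have "t * N (h - ?z) = N (t *\<^sub>R h - z)"
      using scale [of "t *\<^sub>R h - z" "inverse t"] t z(1) h by (simp add: mem_diff mem_scale)
    then have "t * N (h - ?z) \<le> t * (N h / 2)"
      using z(3) t by simp
    then have "N (h - ?z) \<le> N h / 2"
      using t by simp
    ultimately show ?thesis using mem_scale [OF z(1)] by blast
  qed
  then obtain a where a: "\<And>h. h \<in> S \<Longrightarrow> a h \<in> S" "\<And>h. h \<in> S \<Longrightarrow> p (a h) \<le> c * N h"
    "\<And>h. h \<in> S \<Longrightarrow> N (h - a h) \<le> N h / 2"
    by metis
  have "p h \<le> (2 * c) * N h" if h: "h \<in> S" for h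
  proof -
    define R where "R k = ((\<lambda>g. g - a g) ^^ k) h" for k
    have R0: "R 0 = h" and RSuc: "R (Suc k) = R k - a (R k)" for k
      by (simp_all add: R_def)
    have mem: "R k \<in> S" for k
      by (induction k) (simp_all add: R0 RSuc h mem_diff a(1))
    have NR: "N (R k) \<le> N h * (1/2) ^ k" for k
    proof (induction k)
      case (Suc k)
      then show ?case using a(3) [OF mem, of k] by (simp add: RSuc)
    qed (simp add: R0)
    have "(\<Sum>i<k. a (R i)) = h - R k" for k
      by (induction k) (simp_all add: R0 RSuc)
    then have "N ((\<Sum>i<k. a (R i)) - h) = N (R k)" for k
      using minus_commute [OF mem_0 mem [of k]] by simp
    moreover have "(\<lambda>k. N (R k)) \<longlonglongrightarrow> 0"
    proof (rule tendsto_sandwich [OF _ _ tendsto_const])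
      show "(\<lambda>k. N h * (1/2) ^ k) \<longlonglongrightarrow> 0"
        by (intro tendsto_mult_right_zero LIMSEQ_realpow_zero) simp_all
    qed (simp_all add: NR nonneg mem)
    ultimately have lim: "(\<lambda>k. N ((\<Sum>i<k. a (R i)) - h)) \<longlonglongrightarrow> 0"
      by simp
    have geo: "(\<lambda>k. c * N h * (1/2) ^ k) sums (c * N h * 2)"
      using sums_mult [OF geometric_sums [of "1/2 :: real"], of "c * N h"] by simp
    have bound: "p (a (R k)) \<le> c * N h * (1/2) ^ k" for k
      using order_trans [OF a(2) [OF mem] mult_left_mono [OF NR c]] by (simp add: mult.assoc)
    have sum: "summable (\<lambda>k. p (a (R k)))"
      by (rule summable_comparison_test' [OF sums_summable [OF geo]])
        (simp add: bound p_nonneg a(1) mem)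
    have "p h \<le> (\<Sum>k. p (a (R k)))"
      by (rule p_subadd [OF a(1) [OF mem] h lim sum])
    also have "\<dots> \<le> (\<Sum>k. c * N h * (1/2) ^ k)"
      by (rule suminf_le [OF bound sum sums_summable [OF geo]])
    finally show ?thesis using geo by (simp add: sums_iff)
  qed
  then show ?thesis using c by (intro exI [of _ "2 * c"]) simp
qed

end
section \<open>Ideals with a complete norm and a bounded approximate identity are closed\<close>

lemma complete_norm_UNIV: "complete_norm (UNIV :: 'v::banach set) norm"
proof
  fix \<sigma> :: "nat \<Rightarrow> 'v"
  assume "\<And>\<epsilon>. 0 < \<epsilon> \<Longrightarrow> \<exists>n0. \<forall>m\<ge>n0. \<forall>n\<ge>n0. norm (\<sigma> m - \<sigma> n) < \<epsilon>"
  then have "Cauchy \<sigma>" by (intro CauchyI)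
  then obtain l where "\<sigma> \<longlonglongrightarrow> l"
    using Cauchy_convergent convergent_def by blast
  then have "(\<lambda>n. norm (\<sigma> n - l)) \<longlonglongrightarrow> 0"
    by (simp add: tendsto_norm_zero_iff LIM_zero_iff)
  then show "\<exists>l\<in>UNIV. (\<lambda>n. norm (\<sigma> n - l)) \<longlonglongrightarrow> 0" by blast
qed (simp_all add: norm_triangle_ineq)

lemma continuously_included_tendsto:
  assumes inc: "continuously_included D N" and mem: "\<And>i. x i - l \<in> D"
    and lim: "((\<lambda>i. N (x i - l)) \<longlongrightarrow> 0) F"
  shows "(x \<longlongrightarrow> l) F"
proof -
  obtain C where C: "\<And>d. d \<in> D \<Longrightarrow> norm d \<le> C * N d"
    using inc unfolding continuously_included_def by blast
  have "((\<lambda>i. x i - l) \<longlongrightarrow> 0) F"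
  proof (rule Lim_null_comparison)
    show "\<forall>\<^sub>F i in F. norm (x i - l) \<le> C * N (x i - l)"
      by (intro always_eventually allI C mem)
    show "((\<lambda>i. C * N (x i - l)) \<longlongrightarrow> 0) F"
      using tendsto_mult_right_zero [OF lim] .
  qed
  then show ?thesis by (simp add: LIM_zero_iff)
qed

text \<open>
  The series converges in \<open>N\<close> by completeness, and its \<open>N\<close>-limit is also its limit in the
  ambient norm. This replaces the verification that a graph is closed: sums may be
  identified in the weaker ambient norm.
\<close>

lemma continuously_included_countably_subadditive:
  fixes D :: "'v::real_normed_vector set"
  assumes D: "complete_norm D N" and inc: "continuously_included D N"
    and x: "\<And>n. x n \<in> D" and sum: "summable (\<lambda>n. N (x n))" and s: "x sums s"
  shows "N s \<le> (\<Sum>n. N (x n))"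
proof -
  interpret complete_norm D N by (rule D)
  obtain l where l: "l \<in> D" "(\<lambda>n. N ((\<Sum>i<n. x i) - l)) \<longlonglongrightarrow> 0" "N l \<le> (\<Sum>n. N (x n))"
    using summable_imp_convergent [OF x sum] .
  have "(\<lambda>n. \<Sum>i<n. x i) \<longlonglongrightarrow> l"
    by (rule continuously_included_tendsto [OF inc _ l(2)]) (intro mem_diff mem_sum x l)
  then have "s = l"
    using s LIMSEQ_unique unfolding sums_def by blast
  with l show ?thesis by simp
qed

text \<open>
  The first use of Zabreiko's lemma, on \<open>(D, N)\<close>, bounds \<open>d \<mapsto> N (a * d)\<close> for each \<open>a\<close>. Hence
  the supremum of \<open>N (a * d)\<close> over the unit ball of \<open>D\<close> is finite, and the second use, on the
  ambient algebra, bounds it in terms of \<open>norm a\<close>.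
\<close>

lemma left_ideal_multiplication_bounded:
  fixes D :: "'v::{real_normed_algebra, banach} set"
  assumes D: "complete_norm D N" and inc: "continuously_included D N"
    and ideal: "\<And>a d. d \<in> D \<Longrightarrow> a * d \<in> D"
  obtains K where "0 \<le> K" "\<And>a d. d \<in> D \<Longrightarrow> N (a * d) \<le> K * norm a * N d"
proof -
  interpret complete_norm D N by (rule D)
  interpret A: complete_norm "UNIV :: 'v set" norm by (rule complete_norm_UNIV)
  have mult_left: "\<exists>K\<ge>0. \<forall>d\<in>D. N (a * d) \<le> K * N d" for a
  proof (rule countably_subadditive_bounded)
    show "0 \<le> N (a * d)" if "d \<in> D" for d by (rule nonneg [OF ideal [OF that]])
    show "N (a * r *\<^sub>R d) = \<bar>r\<bar> * N (a * d)" if "d \<in> D" for r d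
      using scale [OF ideal [OF that]] by simp
    fix x s
    assume x: "\<And>n. x n \<in> D" and s: "s \<in> D" "(\<lambda>n. N ((\<Sum>i<n. x i) - s)) \<longlonglongrightarrow> 0"
      and sum: "summable (\<lambda>n. N (a * x n))"
    have "x sums s"
      unfolding sums_def
      by (rule continuously_included_tendsto [OF inc _ s(2)]) (intro mem_diff mem_sum x s)
    then have "(\<lambda>n. a * x n) sums (a * s)" by (rule sums_mult)
    then show "N (a * s) \<le> (\<Sum>n. N (a * x n))"
      by (intro continuously_included_countably_subadditive [OF D inc ideal [OF x] sum])
  qed
  define B where "B = {d\<in>D. N d \<le> 1}"
  have B: "d \<in> D" "N d \<le> 1" if "d \<in> B" for d using that by (auto simp: B_def)
  have "B \<noteq> {}" using mem_0 eq_0 [of 0] by (auto simp: B_def)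
  have bdd: "bdd_above ((\<lambda>d. N (a * d)) ` B)" for a
  proof -
    obtain K where K: "0 \<le> K" "\<And>d. d \<in> D \<Longrightarrow> N (a * d) \<le> K * N d"
      using mult_left by blast
    show ?thesis
    proof (rule bdd_aboveI2)
      show "N (a * d) \<le> K" if "d \<in> B" for d
        using K(2) [OF B(1) [OF that]] mult_left_mono [OF B(2) [OF that] K(1)] by simp
    qed
  qed
  define p where "p a = (SUP d\<in>B. N (a * d))" for a
  have upper: "N (a * d) \<le> p a" if "d \<in> B" for a d
    unfolding p_def by (rule cSUP_upper [OF that bdd])
  have p_nonneg: "0 \<le> p a" for a
    using \<open>B \<noteq> {}\<close> upper nonneg [OF ideal] B(1) by (meson all_not_in_conv order_trans)
  have p_scale_le: "p (r *\<^sub>R a) \<le> \<bar>r\<bar> * p a" for r a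
    unfolding p_def [of "r *\<^sub>R a"]
  proof (rule cSUP_least [OF \<open>B \<noteq> {}\<close>])
    show "N (r *\<^sub>R a * d) \<le> \<bar>r\<bar> * p a" if "d \<in> B" for d
      using scale [OF ideal [OF B(1) [OF that]], of r a] upper [OF that, of a]
      by (simp add: mult_left_mono)
  qed
  have "\<exists>K\<ge>0. \<forall>a\<in>UNIV. p a \<le> K * norm a"
  proof (rule A.countably_subadditive_bounded)
    show "p (r *\<^sub>R a) = \<bar>r\<bar> * p a" for r a
    proof (cases "r = 0")
      case True
      then show ?thesis using p_scale_le [of 0 a] p_nonneg [of 0] by simp
    next
      case False
      then have "\<bar>r\<bar> * p a \<le> p (r *\<^sub>R a)"
        using p_scale_le [of "inverse r" "r *\<^sub>R a"] by (simp add: field_simps)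
      with p_scale_le [of r a] show ?thesis by simp
    qed
    fix x s
    assume "(\<lambda>n. norm ((\<Sum>i<n. x i) - s)) \<longlonglongrightarrow> 0" and sum: "summable (\<lambda>n. p (x n))"
    then have s: "x sums s"
      by (simp add: sums_def tendsto_norm_zero_iff LIM_zero_iff)
    show "p s \<le> (\<Sum>n. p (x n))"
      unfolding p_def [of s]
    proof (rule cSUP_least [OF \<open>B \<noteq> {}\<close>])
      fix d assume d: "d \<in> B"
      have mem: "x n * d \<in> D" for n by (rule ideal [OF B(1) [OF d]])
      have sum': "summable (\<lambda>n. N (x n * d))"
        by (rule summable_comparison_test' [OF sum]) (simp add: nonneg mem upper d)
      have "N (s * d) \<le> (\<Sum>n. N (x n * d))"
        by (rule continuously_included_countably_subadditive [OF D inc mem sum' sums_mult2 [OF s]])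
      also have "\<dots> \<le> (\<Sum>n. p (x n))"
        by (rule suminf_le [OF upper [OF d] sum' sum])
      finally show "N (s * d) \<le> (\<Sum>n. p (x n))" .
    qed
  qed (rule p_nonneg)
  then obtain K where K: "0 \<le> K" "\<And>a. p a \<le> K * norm a" by auto
  have "N (a * d) \<le> K * norm a * N d" if d: "d \<in> D" for a d
  proof (cases "d = 0")
    case True
    then show ?thesis using eq_0 [of 0] mem_0 by simp
  next
    case False
    then have pos: "0 < N d" using nonneg [OF d] eq_0 [OF d] by simp
    then have "inverse (N d) *\<^sub>R d \<in> B"
      using scale [OF d, of "inverse (N d)"] mem_scale [OF d] by (simp add: B_def)
    then have "N (a * (inverse (N d) *\<^sub>R d)) \<le> K * norm a"
      using upper K(2) order_trans by blast
    then have "inverse (N d) * N (a * d) \<le> K * norm a"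
      using scale [OF ideal [OF d], of "inverse (N d)" a] pos by simp
    then show ?thesis
      using pos by (simp add: field_simps)
  qed
  with K(1) that show ?thesis by blast
qed

text \<open>
  Since \<open>N d\<close> is at most the limit of \<open>N (d * e i)\<close>, and \<open>N (d * e i)\<close> is controlled by
  \<open>norm d\<close>, the norm \<open>N\<close> is equivalent to the ambient norm on \<open>D\<close>.
\<close>

proposition left_ideal_with_bounded_approximate_identity_closed:
  fixes D :: "'v::{real_normed_algebra, banach} set"
  assumes D: "complete_norm D N" and inc: "continuously_included D N"
    and ideal: "\<And>a d. d \<in> D \<Longrightarrow> a * d \<in> D"
    and bai: "bounded_approximate_identity D N e \<F>"
  shows "closed D"
proof -
  interpret complete_norm D N by (rule D)
  obtain K where K: "0 \<le> K" "\<And>a d. d \<in> D \<Longrightarrow> N (a * d) \<le> K * norm a * N d"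
    using left_ideal_multiplication_bounded [OF D inc ideal] by blast
  obtain M where M: "\<And>i. N (e i) \<le> M" and e: "\<And>i. e i \<in> D" and nontrivial: "\<F> \<noteq> bot"
    and lim: "\<And>d. d \<in> D \<Longrightarrow> ((\<lambda>i. N (d * e i - d)) \<longlongrightarrow> 0) \<F>"
    using bai unfolding bounded_approximate_identity_def by blast
  have equiv: "N d \<le> K * M * norm d" if d: "d \<in> D" for d
  proof -
    have "N d - K * M * norm d \<le> N (d * e i - d)" for i
    proof -
      have "N d \<le> N (d * e i) + N (d * e i - d)"
        using triangle_diff [of "d * e i" "d * e i - d"] d ideal [OF e] by (simp add: mem_diff)
      also have "N (d * e i) \<le> K * norm d * M"
        using K(2) [OF e, of d i] mult_left_mono [OF M [of i], of "K * norm d"] K(1) by simp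
      finally show ?thesis by (simp add: mult_ac)
    qed
    then have "N d - K * M * norm d \<le> 0"
      by (intro tendsto_lowerbound [OF lim [OF d] _ nontrivial]) simp
    then show ?thesis by simp
  qed
  show ?thesis
    unfolding closed_sequential_limits
  proof (intro allI impI, elim conjE)
    fix x l assume x: "\<forall>n. x n \<in> D" and l: "x \<longlonglongrightarrow> l"
    have "\<exists>n0. \<forall>m\<ge>n0. \<forall>n\<ge>n0. N (x m - x n) < \<epsilon>" if "0 < \<epsilon>" for \<epsilon>
    proof -
      \<comment> \<open>A positive constant above \<open>K * M\<close>, to divide by.\<close>
      let ?L = "\<bar>K * M\<bar> + 1"
      have L: "0 < ?L" by simp
      obtain n0 where n0: "\<And>m n. n0 \<le> m \<Longrightarrow> n0 \<le> n \<Longrightarrow> norm (x m - x n) < \<epsilon> / ?L"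
        using LIMSEQ_imp_Cauchy [OF l] \<open>0 < \<epsilon>\<close> L unfolding Cauchy_iff by (meson divide_pos_pos)
      have "N (x m - x n) < \<epsilon>" if "n0 \<le> m" "n0 \<le> n" for m n
      proof -
        have "N (x m - x n) \<le> K * M * norm (x m - x n)"
          using x by (intro equiv mem_diff) auto
        also have "\<dots> \<le> ?L * norm (x m - x n)"
          by (intro mult_right_mono) auto
        also have "\<dots> < \<epsilon>"
          using n0 [OF that] L by (simp add: field_simps)
        finally show ?thesis .
      qed
      then show ?thesis by blast
    qed
    then obtain l' where l': "l' \<in> D" "(\<lambda>n. N (x n - l')) \<longlonglongrightarrow> 0"
      using complete [of x] x by blast
    have "x \<longlonglongrightarrow> l'"
      by (rule continuously_included_tendsto [OF inc _ l'(2)]) (use x l'(1) mem_diff in blast)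
    with l l'(1) show "l \<in> D"
      using LIMSEQ_unique by blast
  qed
qed

section \<open>Weak cluster points\<close>

context banach_algebra_over
begin

lemma complete_algebra_norm_imp_complete_norm:
  assumes "subspace D" and N: "complete_algebra_norm_on smul D N"
  shows "complete_norm D N"
proof
  show "Real_Vector_Spaces.subspace D"
    by (rule subspace_imp_real_subspace [OF assms(1)])
  show "N (r *\<^sub>R x) = \<bar>r\<bar> * N x" if "x \<in> D" for r x
  proof -
    have "N (smul (of_real r) x) = norm (of_real r :: 'k) * N x"
      using N that unfolding complete_algebra_norm_on_def by blast
    then show ?thesis by (simp add: scale_of_real)
  qed
  show "\<exists>l\<in>D. (\<lambda>n. N (\<sigma> n - l)) \<longlonglongrightarrow> 0"
    if "range \<sigma> \<subseteq> D" "\<And>\<epsilon>. 0 < \<epsilon> \<Longrightarrow> \<exists>n0. \<forall>m\<ge>n0. \<forall>n\<ge>n0. N (\<sigma> m - \<sigma> n) < \<epsilon>" for \<sigma>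
    using N that unfolding complete_algebra_norm_on_def by blast
qed (use N in \<open>auto simp: complete_algebra_norm_on_def\<close>)

lemma dual_space_bounded_linear: "f \<in> dual_space smul \<Longrightarrow> bounded_linear f"
  by (simp add: dual_space_def)

lemma dual_space_translate:
  assumes "f \<in> dual_space smul" shows "(\<lambda>x. f (x * d)) \<in> dual_space smul"
  using assms bounded_linear_compose [OF _ bounded_linear_mult_left, of f d]
  by (simp add: dual_space_def scale_mult_left)

text \<open>
  Compactness for filters: if no point were a cluster point, each would have a weakly open
  neighbourhood that the net eventually leaves; finitely many of these cover the compact
  closure of the image of the unit ball, which the net never leaves.
\<close>

lemma weakly_compact_operator_cluster_point:
  assumes T: "weakly_compact_operator smul T" and nontrivial: "\<F> \<noteq> bot"
    and y: "\<And>i. norm (y i) \<le> R"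
  shows "\<exists>x. \<forall>f\<in>dual_space smul. \<forall>U. open U \<longrightarrow> f x \<in> U \<longrightarrow> (\<exists>\<^sub>F i in \<F>. f (T (y i)) \<in> U)"
proof -
  let ?X = "weak_topology smul"
  \<comment> \<open>Only the unit ball has relatively compact image by definition, so the net is scaled into it.\<close>
  define r where "r = \<bar>R\<bar> + 1"
  have r: "0 < r" "norm (y i) \<le> r" for i
    using y [of i] by (auto simp: r_def)
  define z where "z i = T (inverse r *\<^sub>R y i)" for i
  have T_lin: "bounded_linear T"
    using T by (simp add: weakly_compact_operator_def)
  then interpret T: bounded_linear T .
  have Tz: "T (y i) = r *\<^sub>R z i" for i
    using r(1) by (simp add: z_def T.scaleR)
  have open_weak: "openin ?X (f -` U)" if "f \<in> dual_space smul" "open U" for f U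
    unfolding weak_topology_def using that by (intro topology_generated_by_Basis) blast
  have "(\<lambda>x. 0) \<in> dual_space smul"
    by (simp add: dual_space_def)
  then have top: "topspace ?X = UNIV"
    using openin_subset [OF open_weak [OF _ open_UNIV]] by auto
  have "inverse r *\<^sub>R y i \<in> cball 0 1" for i
    using r by (simp add: field_simps)
  then have z_mem: "z i \<in> ?X closure_of (T ` cball 0 1)" for i
    using closure_of_subset [of "T ` cball 0 1" ?X] top unfolding z_def by blast
  have "\<exists>x. \<forall>f U. f \<in> dual_space smul \<longrightarrow> open U \<longrightarrow> f x \<in> U \<longrightarrow> (\<exists>\<^sub>F i in \<F>. f (z i) \<in> U)"
  proof (rule ccontr)
    assume no_cluster: "\<not> ?thesis"
    have "\<exists>V. openin ?X V \<and> x \<in> V \<and> (\<forall>\<^sub>F i in \<F>. z i \<notin> V)" for x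
    proof -
      obtain f U where fU: "f \<in> dual_space smul" "open U" "f x \<in> U" "\<not> (\<exists>\<^sub>F i in \<F>. f (z i) \<in> U)"
        using no_cluster by blast
      then show ?thesis
        by (intro exI [of _ "f -` U"]) (simp add: open_weak not_frequently)
    qed
    then obtain V where V: "\<And>x. openin ?X (V x)" "\<And>x. x \<in> V x" "\<And>x. \<forall>\<^sub>F i in \<F>. z i \<notin> V x"
      by metis
    have "compactin ?X (?X closure_of (T ` cball 0 1))"
      using T by (simp add: weakly_compact_operator_def)
    moreover have "?X closure_of (T ` cball 0 1) \<subseteq> \<Union> (range V)"
      using V(2) by blast
    ultimately obtain \<V> where
      \<V>: "finite \<V>" "\<V> \<subseteq> range V" "?X closure_of (T ` cball 0 1) \<subseteq> \<Union>\<V>"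
      using compactinD [of ?X "?X closure_of (T ` cball 0 1)" "range V"] V(1) by auto
    have "\<forall>\<^sub>F i in \<F>. z i \<notin> W" if "W \<in> \<V>" for W
      using V(3) \<V>(2) that by blast
    then have "\<forall>\<^sub>F i in \<F>. \<forall>W\<in>\<V>. z i \<notin> W"
      by (intro eventually_ball_finite \<V>(1) ballI)
    moreover have "\<not> (\<forall>W\<in>\<V>. z i \<notin> W)" for i
      using \<V>(3) z_mem [of i] by blast
    ultimately have "\<forall>\<^sub>F i in \<F>. False"
      by simp
    with nontrivial show False by simp
  qed
  then obtain x where x: "\<And>f U. f \<in> dual_space smul \<Longrightarrow> open U \<Longrightarrow> f x \<in> U \<Longrightarrow> \<exists>\<^sub>F i in \<F>. f (z i) \<in> U"
    by blast
  show ?thesis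
  proof (intro exI ballI allI impI)
    fix f :: "'a \<Rightarrow> 'k" and U
    assume f: "f \<in> dual_space smul" and U: "open U" "f (r *\<^sub>R x) \<in> U"
    interpret f: bounded_linear f by (rule dual_space_bounded_linear [OF f])
    have "open ((\<lambda>c. r *\<^sub>R c) -` U)"
      by (intro open_vimage U continuous_intros)
    then show "\<exists>\<^sub>F i in \<F>. f (T (y i)) \<in> U"
      using x [OF f, of "(\<lambda>c. r *\<^sub>R c) -` U"] U by (simp add: f.scaleR Tz)
  qed
qed

lemma weakly_compact_operator_limit_point:
  assumes "weakly_compact_operator smul T" and nontrivial: "\<F> \<noteq> bot"
    and "\<And>i. norm (y i) \<le> R"
  shows "\<exists>x. \<forall>f\<in>dual_space smul. \<forall>c. ((\<lambda>i. f (T (y i))) \<longlongrightarrow> c) \<F> \<longrightarrow> f x = c"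
proof -
  obtain x where x: "\<forall>f\<in>dual_space smul. \<forall>U. open U \<longrightarrow> f x \<in> U \<longrightarrow>
      (\<exists>\<^sub>F i in \<F>. f (T (y i)) \<in> U)"
    using weakly_compact_operator_cluster_point [where y = y, OF assms] ..
  show ?thesis
  proof (intro exI ballI allI impI)
    fix f c assume f: "f \<in> dual_space smul" and lim: "((\<lambda>i. f (T (y i))) \<longlongrightarrow> c) \<F>"
    show "f x = c"
    proof (rule ccontr)
      assume "f x \<noteq> c"
      then obtain U V where UV: "open U" "open V" "f x \<in> U" "c \<in> V" "U \<inter> V = {}"
        using hausdorff by metis
      have "\<exists>\<^sub>F i in \<F>. f (T (y i)) \<in> U"
        using x f UV by blast
      moreover have "\<forall>\<^sub>F i in \<F>. f (T (y i)) \<in> V"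
        using topological_tendstoD [OF lim UV(2,4)] .
      then have "\<forall>\<^sub>F i in \<F>. \<not> f (T (y i)) \<in> U"
        by (rule eventually_mono) (use UV(5) in auto)
      ultimately show False
        by (simp add: frequently_def)
    qed
  qed
qed

text \<open>
  The approximate identity acts twice: on the right it makes \<open>D\<close> closed, and on the left it
  identifies the weak cluster point of \<open>a * e i\<close> as \<open>a\<close>.
\<close>

theorem essential_ideal_with_bounded_approximate_identity_eq_UNIV:
  assumes compact: "weakly_compact_algebra smul"
    and essential: "essential_ideal smul D"
    and N: "complete_algebra_norm_on smul D N"
    and inc: "continuously_included D N"
    and bai: "bounded_approximate_identity D N e \<F>"
  shows "D = UNIV"
proof -
  have D: "subspace D" and ideal: "\<And>a d. d \<in> D \<Longrightarrow> a * d \<in> D"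
    and inj: "inj (\<lambda>a. restrict (\<lambda>d. a * d) D)"
    using essential by (auto simp: essential_ideal_def algebra_ideal_def)
  have cn: "complete_norm D N"
    by (rule complete_algebra_norm_imp_complete_norm [OF D N])
  then interpret complete_norm D N .
  have "closed D"
    using left_ideal_with_bounded_approximate_identity_closed [OF cn inc ideal bai] .
  obtain M where nontrivial: "\<F> \<noteq> bot" and e: "\<And>i. e i \<in> D" and M: "\<And>i. N (e i) \<le> M"
    and lim: "\<And>d. d \<in> D \<Longrightarrow> ((\<lambda>i. N (e i * d - d)) \<longlongrightarrow> 0) \<F>"
    using bai unfolding bounded_approximate_identity_def by blast
  have e_lim: "((\<lambda>i. e i * d) \<longlongrightarrow> d) \<F>" if "d \<in> D" for d
    by (rule continuously_included_tendsto [OF inc _ lim [OF that]])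
      (intro mem_diff ideal that)
  obtain C where C: "\<And>d. d \<in> D \<Longrightarrow> norm d \<le> C * N d"
    using inc unfolding continuously_included_def by blast
  have bounded: "norm (e i) \<le> \<bar>C\<bar> * M" for i
  proof -
    have "norm (e i) \<le> C * N (e i)" by (rule C [OF e])
    also have "\<dots> \<le> \<bar>C\<bar> * N (e i)" by (intro mult_right_mono nonneg e) simp
    also have "\<dots> \<le> \<bar>C\<bar> * M" by (intro mult_left_mono M) simp
    finally show ?thesis .
  qed
  have "a \<in> D" for a
  proof (rule ccontr)
    assume "a \<notin> D"
    have mult: "weakly_compact_operator smul ((*) a)"
      using compact by (simp add: weakly_compact_algebra_def)
    obtain x where
      "\<forall>f\<in>dual_space smul. \<forall>c. ((\<lambda>i. f (a * e i)) \<longlongrightarrow> c) \<F> \<longrightarrow> f x = c"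
      using weakly_compact_operator_limit_point [where y = e, OF mult nontrivial bounded] ..
    then have x: "f x = c" if "f \<in> dual_space smul" "((\<lambda>i. f (a * e i)) \<longlongrightarrow> c) \<F>" for f c
      using that by blast
    have "x * d = a * d" if d: "d \<in> D" for d
    proof (rule dual_space_separates_points)
      fix f :: "'a \<Rightarrow> 'k" assume f: "f \<in> dual_space smul"
      have "((\<lambda>i. f (a * (e i * d))) \<longlongrightarrow> f (a * d)) \<F>"
        by (intro bounded_linear.tendsto [OF dual_space_bounded_linear [OF f]]
            tendsto_mult_left e_lim d)
      then show "f (x * d) = f (a * d)"
        using x [OF dual_space_translate [OF f, of d]] by (simp add: mult.assoc)
    qed
    then have "restrict (\<lambda>d. x * d) D = restrict (\<lambda>d. a * d) D"
      by (auto simp: restrict_def)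
    then have "x = a" using inj by (simp add: inj_def)
    obtain f where f: "f \<in> dual_space smul" "\<And>d. d \<in> D \<Longrightarrow> f d = 0" "f a \<noteq> 0"
      using closed_subspace_separation [OF D \<open>closed D\<close> \<open>a \<notin> D\<close>] by blast
    have "f x = 0"
      by (rule x [OF f(1)]) (simp add: f(2) ideal e)
    with f(3) \<open>x = a\<close> show False by simp
  qed
  then show ?thesis by blast
qed

end

theorem proposition1p2:
  fixes smul :: "'k::{real_normed_field, euclidean_space}
      \<Rightarrow> 'a::{real_normed_algebra, banach, comm_ring} \<Rightarrow> 'a"
    and D :: "'a set" and N :: "'a \<Rightarrow> real"
    and e :: "'i \<Rightarrow> 'a" and \<F> :: "'i filter"
  assumes "banach_algebra_over smul"
    and "arens_regular smul"
    and "weakly_compact_algebra smul"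
    and "essential_ideal smul D"
    and "complete_algebra_norm_on smul D N"
    and "continuously_included D N"
    and "bounded_approximate_identity D N e \<F>"
  shows "D = UNIV"
  using banach_algebra_over.essential_ideal_with_bounded_approximate_identity_eq_UNIV
    [OF assms(1) assms(3-7)] .

end
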